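(* For all real $a,b>0$ with $a\neq b$, writing $P=P(a,b)$, $X=X(a,b)$ and $M_p=M_p(a,b)$, one has $$M_{1/2}<\frac{P+X}{2}<M_k,$$ where $k=\dfrac{5\log 2+2}{6(\log 2+1)}\approx 0.5380$.
   Context: For real $a,b>0$ with $a\neq b$: $A(a,b)=\frac{a+b}{2}$, $G(a,b)=\sqrt{ab}$, $P(a,b)=\dfrac{a-b}{2\arcsin\left(\frac{a-b}{a+b}\right)}$ (Seiffert mean), and $X(a,b)=A\,e^{G/P-1}$. For $p\in\mathbb{R}$ the power mean is $M_p(a,b)=\left(\frac{a^p+b^p}{2}\right)^{1/p}$ if $p\neq0$ and $M_0(a,b)=\sqrt{ab}$. *)

theory Defs
  imports "HOL-Analysis.Analysis"
begin

text \<open>Bivariate means of two positive real arguments. The Seiffert mean and hence \<open>X_mean\<close> are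
  meaningful only for distinct arguments: on the diagonal the Seiffert quotient is \<open>0 / 0 = 0\<close> here,
  not its continuous extension.\<close>

definition arith_mean :: "real \<Rightarrow> real \<Rightarrow> real" where
  "arith_mean a b = (a + b) / 2"

definition geom_mean :: "real \<Rightarrow> real \<Rightarrow> real" where
  "geom_mean a b = sqrt (a * b)"

definition seiffert_mean :: "real \<Rightarrow> real \<Rightarrow> real" where
  "seiffert_mean a b = (a - b) / (2 * arcsin ((a - b) / (a + b)))"

definition X_mean :: "real \<Rightarrow> real \<Rightarrow> real" where
  "X_mean a b = arith_mean a b * exp (geom_mean a b / seiffert_mean a b - 1)"

definition power_mean :: "real \<Rightarrow> real \<Rightarrow> real \<Rightarrow> real" where
  "power_mean p a b =
     (if p = 0 then sqrt (a * b) else ((a powr p + b powr p) / 2) powr (1 / p))"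

end

theory Submission
  imports Defs "HOL-Real_Asymp.Real_Asymp"
begin

text \<open>Normalising \<open>A = 1\<close> and writing \<open>(a - b) / (a + b) = sin t\<close> with \<open>0 < t < \<pi>/2\<close> turns the means
  into \<open>G = cos t\<close>, \<open>P = sin t / t\<close> and \<open>X = exp (t cot t - 1)\<close>, while \<open>M\<^bsub>1/2\<^esub> = (A + G) / 2\<close>.
  The lower bound says that \<open>t cot t - 1 - ln (1 + G - P)\<close>, which tends to 0 at 0, is positive;
  its derivative has the sign of \<open>(1 - P) (P\<^sup>2 + P - 1 - G)\<close>, which is positive by Taylor
  estimates.  For the upper bound, \<open>P < (2 A + G) / 3\<close> and \<open>X < (2 A + 3 G) / 5\<close> add up to
  \<open>(P + X) / 2 < \<alpha> A + (1 - \<alpha>) G\<close> with \<open>\<alpha> = 8/15\<close>.  On the other hand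
  \<open>k A + (1 - k) G \<le> M\<^sub>k\<close> for \<open>1/2 \<le> k \<le> 1\<close>, and \<open>ln 2 \<ge> 2/3\<close> amounts to \<open>k \<ge> 8/15\<close>
  for the given \<open>k\<close>.\<close>

section \<open>Monotonicity from a one-sided limit, and Taylor bounds\<close>

text \<open>A positive derivative makes \<open>f\<close> strictly increasing right of
  \<open>a\<close>, so \<open>l\<close> is at most the value at the midpoint of \<open>a\<close> and
  \<open>t\<close>, which is strictly below \<open>f t\<close>. A limit replaces the value at
  \<open>a\<close> because quotients such as \<open>sin t / t\<close> take the default value 0 at
  0.\<close>

lemma DERIV_pos_imp_gt_limit_at_right:
  fixes f :: "real \<Rightarrow> real"
  assumes lim: "(f \<longlongrightarrow> l) (at_right a)"
    and deriv: "\<And>x. a < x \<Longrightarrow> x < b \<Longrightarrow> \<exists>y. DERIV f x :> y \<and> y > 0"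
    and t: "a < t" "t < b"
  shows "l < f t"
proof -
  define m where "m = (a + t) / 2"
  have m: "a < m" "m < t" using t by (auto simp: m_def)
  have mono: "f x < f y" if "a < x" "x < y" "y \<le> t" for x y
    by (rule DERIV_pos_imp_increasing[OF \<open>x < y\<close>]) (use that t deriv in auto)
  have "eventually (\<lambda>x. f x \<le> f m) (at_right a)"
    unfolding eventually_at_right_field using m mono by (intro exI[of _ m]) (auto intro!: less_imp_le)
  then have "l \<le> f m"
    using lim by (intro tendsto_upperbound[of f l "at_right a"]) auto
  also have "\<dots> < f t" using mono m by auto
  finally show ?thesis .
qed

lemma cos_le_quartic: "cos x \<le> 1 - x\<^sup>2 / 2 + x ^ 4 / 24" for x :: real
proof -
  obtain t where "cos x = (\<Sum>m<4. cos_coeff m * x ^ m) + cos (t + 1 / 2 * real 4 * pi) / fact 4 * x ^ 4"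
    using Maclaurin_cos_expansion[of x 4] by blast
  also have "cos (t + 1 / 2 * real 4 * pi) / fact 4 * x ^ 4 \<le> 1 / fact 4 * x ^ 4"
    by (intro mult_right_mono divide_right_mono) auto
  also have "(\<Sum>m<4. cos_coeff m * x ^ m) + 1 / fact 4 * x ^ 4 = 1 - x\<^sup>2 / 2 + x ^ 4 / 24"
    by (simp add: lessThan_nat_numeral cos_coeff_def fact_numeral)
  finally show ?thesis by simp
qed

lemma sin_ge_septic:
  assumes "0 \<le> x"
  shows "x - x ^ 3 / 6 + x ^ 5 / 120 - x ^ 7 / 5040 \<le> sin (x :: real)"
proof -
  have "(\<Sum>m<7. sin_coeff m * x ^ m) = x - x ^ 3 / 6 + x ^ 5 / 120"
    by (simp add: lessThan_nat_numeral sin_coeff_def fact_numeral)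
  moreover have "inverse (fact 7) * \<bar>x\<bar> ^ 7 = x ^ 7 / 5040"
    using assms by (simp add: fact_numeral)
  ultimately show ?thesis
    using Maclaurin_sin_bound[of x 7] by linarith
qed

section \<open>Trigonometric inequalities behind both bounds\<close>

text \<open>With \<open>P = sin t / t\<close> and \<open>G = cos t\<close> this is
  \<open>P^2 + P - 1 - G > 0\<close> multiplied by \<open>t^2\<close>. It follows from a polynomial
  lower bound \<open>\<rho>\<close> for \<open>P\<close> and the quartic upper bound for
  \<open>cos t\<close>, both polynomials in \<open>x = t^2\<close>.\<close>

lemma sin_cos_ineq_quadratic:
  assumes t: "0 < t" "t < pi / 2"
  shows "t\<^sup>2 * (1 + cos t) < sin t ^ 2 + t * sin t"
proof -
  define x where "x = t\<^sup>2"
  have "t < 8 / 5" using t(2) pi_approx(2) by simp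
  then have x: "0 < x" "x < 64 / 25"
    using t power_strict_mono[of t "8/5" 2] by (auto simp: x_def power2_eq_square)
  \<comment> \<open>Lowering the Taylor coefficient 1/120 to 1/150 absorbs the term
    \<open>x^3 / 5040\<close>, which keeps \<open>\<rho>\<close> quadratic.\<close>
  define \<rho> where "\<rho> = 1 - x / 6 + x\<^sup>2 / 150"
  have \<rho>_pos: "\<rho> > 0"
    unfolding \<rho>_def using x by (intro add_pos_nonneg) auto
  have "x\<^sup>2 * (1 / 150 + x / 5040 - 1 / 120) \<le> 0"
    using x by (intro mult_nonneg_nonpos) auto
  then have "t * \<rho> \<le> t * (1 - x / 6 + x\<^sup>2 / 120 - x ^ 3 / 5040)"
    unfolding \<rho>_def using t by (intro mult_left_mono) (auto simp: algebra_simps eval_nat_numeral)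
  also have "\<dots> \<le> sin t"
    using sin_ge_septic[of t] t by (simp add: x_def algebra_simps eval_nat_numeral)
  finally have s: "t * \<rho> \<le> sin t" .
  \<comment> \<open>The constant and linear terms of \<open>\<rho>^2 + \<rho>\<close> agree with
    those of the bound for \<open>1 + cos t\<close>, so only higher powers remain. The bracket is
    \<open>11/1800 - x/450\<close>, positive for \<open>x < 11/4\<close>; the bound 64/25
    suffices.\<close>
  have "0 < x\<^sup>2 * (1/50 + 1/36 - 1/24 - x / 450) + x ^ 4 / 22500"
    using x by (intro add_pos_nonneg mult_pos_pos) auto
  also have "\<dots> = \<rho>\<^sup>2 + \<rho> - (2 - x / 2 + x\<^sup>2 / 24)"
    unfolding \<rho>_def by (simp add: field_simps eval_nat_numeral)
  finally have "1 + cos t < \<rho>\<^sup>2 + \<rho>"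
    using cos_le_quartic[of t] by (simp add: x_def eval_nat_numeral)
  then have "t\<^sup>2 * (1 + cos t) < t\<^sup>2 * (\<rho>\<^sup>2 + \<rho>)" using t by simp
  also have "\<dots> = (t * \<rho>)\<^sup>2 + t * (t * \<rho>)" by (simp add: algebra_simps power2_eq_square)
  also have "\<dots> \<le> sin t ^ 2 + t * sin t"
    using s t \<rho>_pos by (intro add_mono power_mono mult_left_mono) auto
  finally show ?thesis .
qed

text \<open>In the normalised means this is \<open>P < (2 A + G) / 3\<close>. Differentiating the
  difference three times leads to \<open>z * sin z > 0\<close>, and the difference and its first two
  derivatives all tend to 0 at 0.\<close>

lemma three_sin_less:
  assumes t: "0 < t" "t < pi / 2"
  shows "3 * sin t < t * (2 + cos t)"
proof -
  have "0 < t * (2 + cos t) - 3 * sin t"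
  proof (rule DERIV_pos_imp_gt_limit_at_right[OF _ _ t, of _ 0])
    show "((\<lambda>t. t * (2 + cos t) - 3 * sin t) \<longlongrightarrow> 0) (at_right (0::real))"
      by real_asymp
    fix x :: real assume x: "0 < x" "x < pi / 2"
    have "0 < 2 - 2 * cos x - x * sin x"
    proof (rule DERIV_pos_imp_gt_limit_at_right[OF _ _ x, of _ 0])
      show "((\<lambda>x. 2 - 2 * cos x - x * sin x) \<longlongrightarrow> 0) (at_right (0::real))"
        by real_asymp
      fix y :: real assume y: "0 < y" "y < pi / 2"
      have "0 < sin y - y * cos y"
      proof (rule DERIV_pos_imp_gt_limit_at_right[OF _ _ y, of _ 0])
        show "((\<lambda>y. sin y - y * cos y) \<longlongrightarrow> 0) (at_right (0::real))"
          by real_asymp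
        fix z :: real assume z: "0 < z" "z < pi / 2"
        then have "0 < z * sin z" by (intro mult_pos_pos sin_gt_zero) auto
        then show "\<exists>d. DERIV (\<lambda>y. sin y - y * cos y) z :> d \<and> d > 0"
          by (intro exI[of _ "z * sin z"]) (auto intro!: derivative_eq_intros)
      qed
      then show "\<exists>d. DERIV (\<lambda>x. 2 - 2 * cos x - x * sin x) y :> d \<and> d > 0"
        by (intro exI[of _ "sin y - y * cos y"]) (auto intro!: derivative_eq_intros)
    qed
    then show "\<exists>d. DERIV (\<lambda>t. t * (2 + cos t) - 3 * sin t) x :> d \<and> d > 0"
      by (intro exI[of _ "2 - 2 * cos x - x * sin x"]) (auto intro!: derivative_eq_intros)
  qed
  then show ?thesis by simp
qed

lemma one_plus_cos_less:
  assumes t: "0 < t" "t < pi / 2"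
  shows "1 + cos t < sin t / t + exp (t * cos t / sin t - 1)"
proof -
  define h where "h = (\<lambda>t::real. 1 + cos t - sin t / t)"
  define F where "F = (\<lambda>t. t * cos t / sin t - 1 - ln (h t))"
  have h_pos: "h x > 0" if "0 < x" "x < pi / 2" for x
  proof -
    have "cos x > 0" using that by (intro cos_gt_zero) auto
    moreover have "sin x / x \<le> 1" using that sin_x_le_x[of x] by simp
    ultimately show ?thesis by (simp add: h_def)
  qed
  have "(F \<longlongrightarrow> 0) (at_right 0)"
    unfolding F_def h_def by real_asymp
  then have "0 < F t"
  proof (rule DERIV_pos_imp_gt_limit_at_right[OF _ _ t])
    fix x :: real assume x: "0 < x" "x < pi / 2"
    define s c where "s = sin x" and "c = cos x"
    have s: "s > 0" unfolding s_def using x by (intro sin_gt_zero) auto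
    \<comment> \<open>The strict inequality \<open>sin x < x\<close> makes the factor
      \<open>x - s\<close> below positive.\<close>
    have "x * (2 + cos x) \<le> x * 3" using x by (intro mult_left_mono) auto
    then have s_less: "s < x" using three_sin_less[OF x] by (simp add: s_def)
    have sc: "s\<^sup>2 + c\<^sup>2 = 1" by (simp add: s_def c_def)
    let ?D = "(s * c - x) / s\<^sup>2 + (s + c / x - s / x\<^sup>2) / h x"
    have dh: "DERIV h x :> - s - c / x + s / x\<^sup>2"
      unfolding h_def s_def c_def
      using x by (auto intro!: derivative_eq_intros simp: field_simps power2_eq_square)
    \<comment> \<open>The left side is the derivative of \<open>x * cos x / sin x\<close> in the
      shape that the quotient rule yields.\<close>
    have "(c - x * s) / s - x * c * c / s\<^sup>2 = (s * c - x * (s\<^sup>2 + c\<^sup>2)) / s\<^sup>2"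
      using s by (simp add: field_simps power2_eq_square)
    then have eq: "(c - x * s) / s - x * c * c / s\<^sup>2 = (s * c - x) / s\<^sup>2"
      using sc by simp
    have "DERIV F x :> (c - x * s) / s - x * c * c / s\<^sup>2 - (- s - c / x + s / x\<^sup>2) / h x"
      unfolding F_def
      using h_pos[OF x] s
      by (auto intro!: derivative_eq_intros dh simp: s_def c_def power2_eq_square diff_divide_distrib)
    then have "DERIV F x :> ?D"
      unfolding eq by (simp add: divide_inverse algebra_simps)
    moreover have "?D > 0"
    proof -
      have c2: "c * c = 1 - s * s" using sc by (simp add: power2_eq_square)
      \<comment> \<open>For \<open>P = s / x\<close> this product is
        \<open>x^3 * (1 - P) * (P^2 + P - 1 - c)\<close>. It turns out to be \<open>?D\<close> with
        its positive denominators cleared.\<close>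
      have "0 < (x - s) * (s\<^sup>2 + x * s - x\<^sup>2 * (1 + c))"
        using s_less sin_cos_ineq_quadratic[OF x] by (simp add: s_def c_def)
      also have "\<dots> = s\<^sup>2 * (x\<^sup>2 * s + x * c - s) - x\<^sup>2 * h x * (x - s * c)"
      proof -
        have "x\<^sup>2 * h x = x\<^sup>2 + x\<^sup>2 * c - x * s"
          using x by (simp add: h_def s_def c_def field_simps power2_eq_square)
        then have "s\<^sup>2 * (x\<^sup>2 * s + x * c - s) - x\<^sup>2 * h x * (x - s * c) =
          s\<^sup>2 * (x\<^sup>2 * s + x * c - s) - (x\<^sup>2 + x\<^sup>2 * c - x * s) * (x - s * c)"
          by (simp only:)
        also have "\<dots> = x\<^sup>2 * s * (s * s + c * c) - s * s * s - x * x * x * (1 + c) + x * x * s * (1 + c)"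
          by (simp add: algebra_simps power2_eq_square)
        finally show ?thesis
          unfolding c2 by (simp add: algebra_simps power2_eq_square)
      qed
      also have "\<dots> = ?D * (s\<^sup>2 * x\<^sup>2 * h x)"
        using s x h_pos[OF x] by (simp add: field_simps power2_eq_square)
      finally show ?thesis
        by (rule zero_less_mult_pos2) (use s x h_pos[OF x] in simp)
    qed
    ultimately show "\<exists>y. DERIV F x :> y \<and> y > 0" by blast
  qed
  then have "ln (h t) < t * cos t / sin t - 1" by (simp add: F_def)
  then have "h t < exp (t * cos t / sin t - 1)"
    using h_pos[OF t] by (metis exp_less_mono exp_ln)
  then show ?thesis by (simp add: h_def)
qed

text \<open>The difference of the two sides, divided by \<open>2 + 3 cos t\<close>, has derivative of the sign of
  \<open>6 cos t - 1\<close>, so it is smallest at the ends of the interval.\<close>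

lemma sin_cube_less:
  assumes t: "0 < t" "t < pi / 2"
  shows "3 * sin t ^ 3 < (t - sin t * cos t) * (2 + 3 * cos t)"
proof -
  define g where "g = (\<lambda>t::real. t - sin t * cos t - 3 * sin t ^ 3 / (2 + 3 * cos t))"
  have c_nonneg: "cos x \<ge> 0" if "0 \<le> x" "x \<le> pi / 2" for x :: real
    using that by (intro cos_ge_zero) auto
  have dg: "DERIV g x :> sin x ^ 2 * (6 * cos x - 1) / (2 + 3 * cos x) ^ 2"
    if "0 \<le> x" "x \<le> pi / 2" for x
  proof -
    define s c where "s = sin x" and "c = cos x"
    have c: "c \<ge> 0" using c_nonneg[OF that] by (simp add: c_def)
    have c2: "c * c = 1 - s * s"
      using sin_cos_squared_add3[of x] by (simp add: s_def c_def algebra_simps)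
    have "1 - (c * c - s * s) - (9 * s\<^sup>2 * c * (2 + 3 * c) + 9 * s\<^sup>2 * s\<^sup>2) / (2 + 3 * c) ^ 2
        = 2 * s\<^sup>2 - s\<^sup>2 * (18 * c + 27 * (c * c) + 9 * (s * s)) / (2 + 3 * c) ^ 2"
      using c2 by (simp add: algebra_simps power2_eq_square)
    also have "\<dots> = s\<^sup>2 * (2 * (2 + 3 * c) ^ 2 - (18 * c + 27 * (c * c) + 9 * (s * s))) / (2 + 3 * c) ^ 2"
      using c by (simp add: field_simps)
    also have "2 * (2 + 3 * c) ^ 2 - (18 * c + 27 * (c * c) + 9 * (s * s)) = 6 * c - 1"
      using c2 by (simp add: algebra_simps power2_eq_square)
    finally have eq: "1 - (c * c - s * s) - (9 * s\<^sup>2 * c * (2 + 3 * c) + 9 * s\<^sup>2 * s\<^sup>2) / (2 + 3 * c) ^ 2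
      = s\<^sup>2 * (6 * c - 1) / (2 + 3 * c) ^ 2" .
    have "DERIV g x :> 1 - (c * c - s * s) - (9 * s\<^sup>2 * c * (2 + 3 * c) + 9 * s\<^sup>2 * s\<^sup>2) / (2 + 3 * c) ^ 2"
      unfolding g_def
      using c
      by (auto intro!: derivative_eq_intros simp: s_def c_def algebra_simps eval_nat_numeral)
    then show ?thesis unfolding eq by (simp add: s_def c_def)
  qed
  have cont: "continuous_on {x..y} g" if "0 \<le> x" "y \<le> pi / 2" for x y
    by (intro continuous_at_imp_continuous_on ballI DERIV_isCont[OF dg]) (use that in auto)
  have sin_pos: "sin x > 0" if "0 < x" "x \<le> pi / 2" for x :: real
    using that pi_gt_zero by (intro sin_gt_zero) auto
  have "g t > 0"
  \<comment> \<open>As cosine decreases, \<open>g\<close> increases up to \<open>cos x = 1/6\<close>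
    and decreases afterwards. So \<open>t\<close> is compared with 0, where \<open>g\<close>
    vanishes, or with \<open>pi / 2\<close>, where \<open>g\<close> equals
    \<open>(pi - 3) / 2\<close>.\<close>
  proof (cases "cos t \<ge> 1 / 6")
    case True
    have "g 0 < g t"
    proof (rule DERIV_pos_imp_increasing_open[OF t(1)])
      fix x assume x: "0 < x" "x < t"
      then have "cos t < cos x" using t by (intro cos_monotone_0_pi) auto
      then have "sin x ^ 2 * (6 * cos x - 1) / (2 + 3 * cos x) ^ 2 > 0"
        using True x t sin_pos[of x] c_nonneg[of x]
        by (intro divide_pos_pos mult_pos_pos zero_less_power) auto
      then show "\<exists>y. DERIV g x :> y \<and> 0 < y" using dg[of x] x t by auto
    qed (use t cont in auto)
    then show ?thesis by (simp add: g_def)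
  next
    case False
    have "g (pi / 2) < g t"
    proof (rule DERIV_neg_imp_decreasing_open[OF t(2)])
      fix x assume x: "t < x" "x < pi / 2"
      then have "cos x < cos t" using t by (intro cos_monotone_0_pi) auto
      then have "sin x ^ 2 * (6 * cos x - 1) / (2 + 3 * cos x) ^ 2 < 0"
        using False x t sin_pos[of x] c_nonneg[of x]
        by (intro divide_neg_pos mult_pos_neg zero_less_power) auto
      then show "\<exists>y. DERIV g x :> y \<and> y < 0" using dg[of x] x t by auto
    qed (use t cont in auto)
    moreover have "g (pi / 2) > 0" using pi_gt3 by (simp add: g_def)
    ultimately show ?thesis by simp
  qed
  then show ?thesis
    using c_nonneg[of t] t by (simp add: g_def field_simps)
qed

text \<open>This is \<open>X < (2 A + 3 G) / 5\<close> for \<open>A = 1\<close>. The difference of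
  the logarithms tends to 0 at 0, and its derivative is positive by \<open>sin_cube_less\<close>
  divided by \<open>s^2 * (2 + 3 * c)\<close>. At \<open>pi / 2\<close> the two sides are
  \<open>1 / e\<close> and the slightly larger 2/5.\<close>

lemma exp_t_cot_less:
  assumes t: "0 < t" "t < pi / 2"
  shows "exp (t * cos t / sin t - 1) < (2 + 3 * cos t) / 5"
proof -
  define F where "F = (\<lambda>t::real. ln (2 + 3 * cos t) - ln 5 - (t * cos t / sin t - 1))"
  have c_pos: "cos x > 0" if "0 < x" "x < pi / 2" for x :: real
    using that by (intro cos_gt_zero) auto
  have "(F \<longlongrightarrow> 0) (at_right 0)"
    unfolding F_def by real_asymp
  then have "0 < F t"
  proof (rule DERIV_pos_imp_gt_limit_at_right[OF _ _ t])
    fix x :: real assume x: "0 < x" "x < pi / 2"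
    define s c where "s = sin x" and "c = cos x"
    have s: "s > 0" unfolding s_def using x by (intro sin_gt_zero) auto
    have c: "c > 0" unfolding c_def using x by (rule c_pos)
    have c2: "c * c = 1 - s * s"
      using sin_cos_squared_add3[of x] by (simp add: s_def c_def algebra_simps)
    let ?D = "(x - s * c) / s\<^sup>2 - 3 * s / (2 + 3 * c)"
    have "(c - x * s) / s - x * c * c / s\<^sup>2 = (s * c - x * (s * s + c * c)) / s\<^sup>2"
      using s by (simp add: field_simps power2_eq_square)
    then have eq: "(c - x * s) / s - x * c * c / s\<^sup>2 = (s * c - x) / s\<^sup>2"
      using c2 by simp
    have "DERIV F x :> - 3 * s / (2 + 3 * c) - ((c - x * s) / s - x * c * c / s\<^sup>2)"
      unfolding F_def
      using s c
      by (auto intro!: derivative_eq_intros simp: s_def c_def power2_eq_square diff_divide_distrib)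
    then have "DERIV F x :> ?D"
      unfolding eq by (simp add: divide_inverse algebra_simps)
    moreover have "?D > 0"
    proof -
      have "3 * s * s\<^sup>2 < (x - s * c) * (2 + 3 * c)"
        using sin_cube_less[OF x] by (simp add: s_def c_def eval_nat_numeral)
      then show ?thesis
        using s c by (simp add: pos_divide_less_eq pos_less_divide_eq)
    qed
    ultimately show "\<exists>y. DERIV F x :> y \<and> y > 0" by blast
  qed
  then have "t * cos t / sin t - 1 < ln ((2 + 3 * cos t) / 5)"
    using c_pos[OF t] by (simp add: F_def ln_div)
  moreover have "(2 + 3 * cos t) / 5 > 0" using c_pos[OF t] by simp
  ultimately show ?thesis by (metis exp_less_mono exp_ln)
qed

section \<open>Hyperbolic functions and the lower bound for power means\<close>

text \<open>For positive \<open>p\<close> this says that \<open>sinh (p * x) / p\<close> grows with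
  \<open>p\<close>; the form without division also covers \<open>p = 0\<close>, which arises below
  as \<open>1 - k\<close> for \<open>k = 1\<close>.\<close>

lemma sinh_mult_mono:
  fixes p q x :: real
  assumes "0 \<le> p" "p \<le> q" "0 \<le> x"
  shows "q * sinh (p * x) \<le> p * sinh (q * x)"
proof -
  have "p * sinh (q * 0) - q * sinh (p * 0) \<le> p * sinh (q * x) - q * sinh (p * x)"
  proof (rule DERIV_nonneg_imp_nondecreasing[OF assms(3)])
    fix y :: real assume y: "0 \<le> y" "y \<le> x"
    have "p * y \<le> q * y" using assms y by (intro mult_right_mono) auto
    then have "cosh (p * y) \<le> cosh (q * y)"
      using assms y by (subst cosh_real_nonneg_le_iff) auto
    then have "0 \<le> p * q * (cosh (q * y) - cosh (p * y))"
      using assms by (intro mult_nonneg_nonneg) auto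
    then show "\<exists>d. DERIV (\<lambda>x. p * sinh (q * x) - q * sinh (p * x)) y :> d \<and> 0 \<le> d"
      by (intro exI[of _ "p * q * (cosh (q * y) - cosh (p * y))"])
         (auto intro!: derivative_eq_intros simp: algebra_simps)
  qed
  then show ?thesis by simp
qed

text \<open>Both sides vanish at 0. Comparing derivatives reduces, by the subtraction formula for
  \<open>sinh\<close>, to \<open>k * sinh ((1 - k) * y) \<le> (1 - k) * sinh (k * y)\<close>. This
  is where \<open>k \<ge> 1/2\<close>, that is \<open>1 - k \<le> k\<close>, enters.\<close>

lemma ln_cosh_ge:
  fixes k x :: real
  assumes k: "1 / 2 \<le> k" "k \<le> 1" and x: "0 \<le> x"
  shows "ln (k * cosh x + (1 - k)) \<le> ln (cosh (k * x)) / k"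
proof -
  have pos: "k * cosh y + (1 - k) > 0" for y
    using k by (intro add_pos_nonneg mult_pos_pos) (auto simp: cosh_real_pos)
  let ?f = "\<lambda>x. ln (cosh (k * x)) / k - ln (k * cosh x + (1 - k))"
  have "?f 0 \<le> ?f x"
  proof (rule DERIV_nonneg_imp_nondecreasing[OF x])
    fix y :: real assume y: "0 \<le> y" "y \<le> x"
    let ?D = "sinh (k * y) / cosh (k * y) - k * sinh y / (k * cosh y + (1 - k))"
    have "DERIV ?f y :> ?D"
      using k pos[of y] by (auto intro!: derivative_eq_intros simp: cosh_real_pos)
    moreover have "?D \<ge> 0"
    proof -
      have "sinh ((1 - k) * y) = sinh y * cosh (k * y) - cosh y * sinh (k * y)"
        using sinh_diff[of y "k * y"] by (simp add: algebra_simps)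
      moreover have "k * sinh ((1 - k) * y) \<le> (1 - k) * sinh (k * y)"
        using k y by (intro sinh_mult_mono) auto
      ultimately have "k * (sinh y * cosh (k * y) - cosh y * sinh (k * y)) \<le> (1 - k) * sinh (k * y)"
        by simp
      then have "k * sinh y * cosh (k * y) \<le> sinh (k * y) * (k * cosh y + (1 - k))"
        by (simp add: algebra_simps)
      then show ?thesis
        using pos[of y] by (simp add: cosh_real_pos pos_divide_le_eq pos_le_divide_eq)
    qed
    ultimately show "\<exists>d. DERIV ?f y :> d \<and> 0 \<le> d" by blast
  qed
  then show ?thesis by simp
qed

text \<open>Writing \<open>a = exp (m + d)\<close> and \<open>b = exp (m - d)\<close> gives every
  mean the factor \<open>exp m\<close>: what remains is \<open>cosh d\<close> for \<open>A\<close>,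
  1 for \<open>G\<close> and \<open>cosh (k * d) powr (1 / k)\<close> for the power mean. The claim
  is then \<open>ln_cosh_ge\<close> exponentiated, with evenness of \<open>cosh\<close> handling
  negative \<open>d\<close>.\<close>

lemma power_mean_ge_convex_combination:
  fixes a b k :: real
  assumes ab: "a > 0" "b > 0" and k: "1 / 2 \<le> k" "k \<le> 1"
  shows "k * arith_mean a b + (1 - k) * geom_mean a b \<le> power_mean k a b"
proof -
  define m d where "m = (ln a + ln b) / 2" and "d = (ln a - ln b) / 2"
  have ln: "ln a = m + d" "ln b = m - d" by (simp_all add: m_def d_def field_simps)
  have a: "a = exp m * exp d" and b: "b = exp m * exp (- d)"
    using ab ln by (metis exp_ln exp_add, metis exp_ln exp_add uminus_add_conv_diff add.commute)
  have A: "arith_mean a b = exp m * cosh d"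
    by (simp add: arith_mean_def a b cosh_def algebra_simps)
  have "a * b = (exp m)\<^sup>2"
    by (simp add: a b power2_eq_square exp_minus)
  then have G: "geom_mean a b = exp m" by (simp add: geom_mean_def)
  have "(a powr k + b powr k) / 2 = exp (k * m) * cosh (k * d)"
    using ab by (simp add: powr_def ln cosh_def exp_add algebra_simps flip: exp_add)
  also have "\<dots> = exp (k * m + ln (cosh (k * d)))"
    by (simp add: exp_add cosh_real_pos)
  finally have M: "power_mean k a b = exp m * exp (ln (cosh (k * d)) / k)"
    using k by (simp add: power_mean_def powr_def add_divide_distrib flip: exp_add)
  have "k * cosh d + (1 - k) > 0"
    using k by (intro add_pos_nonneg mult_pos_pos) (auto simp: cosh_real_pos)
  moreover have "ln (k * cosh d + (1 - k)) \<le> ln (cosh (k * d)) / k"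
  proof (cases "d \<ge> 0")
    case False
    then show ?thesis using ln_cosh_ge[OF k, of "- d"] by simp
  qed (rule ln_cosh_ge[OF k])
  ultimately have "k * cosh d + (1 - k) \<le> exp (ln (cosh (k * d)) / k)"
    by (metis exp_le_cancel_iff exp_ln)
  then have "exp m * (k * cosh d + (1 - k)) \<le> exp m * exp (ln (cosh (k * d)) / k)" by simp
  then show ?thesis unfolding A G M by (simp add: algebra_simps)
qed

lemma power_mean_half:
  assumes "a > 0" "b > 0"
  shows "power_mean (1 / 2) a b = (arith_mean a b + geom_mean a b) / 2"
proof -
  have "power_mean (1 / 2) a b = ((sqrt a + sqrt b) / 2)\<^sup>2"
    using assms by (simp add: power_mean_def powr_half_sqrt add_nonneg_nonneg)
  then show ?thesis
    using assms by (simp add: arith_mean_def geom_mean_def real_sqrt_mult power2_eq_square field_simps)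
qed

lemma geom_mean_le_arith_mean:
  assumes "a > 0" "b > 0"
  shows "geom_mean a b \<le> arith_mean a b"
  using assms arith_geo_mean_sqrt[of a b] by (simp add: geom_mean_def arith_mean_def)

section \<open>Return from the angle to the means, and assembly\<close>

text \<open>All means involved are \<open>A\<close> times a function of the angle
  \<open>t = arcsin ((a - b) / (a + b))\<close>, so the trigonometric inequalities transfer after
  multiplication by \<open>A\<close>. The order \<open>b < a\<close> places \<open>t\<close>
  strictly between 0 and \<open>pi / 2\<close>.\<close>

lemma seiffert_X_bounds:
  fixes a b :: real
  assumes "0 < b" "b < a"
  shows "arith_mean a b + geom_mean a b < seiffert_mean a b + X_mean a b"
    and "seiffert_mean a b + X_mean a b < 16 / 15 * arith_mean a b + 14 / 15 * geom_mean a b"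
proof -
  define A where "A = arith_mean a b"
  define u where "u = (a - b) / (a + b)"
  define t where "t = arcsin u"
  have A: "A > 0" using assms by (simp add: A_def arith_mean_def)
  have u: "0 < u" "u < 1" using assms by (auto simp: u_def)
  have sin: "sin t = u" using u by (simp add: t_def)
  have t: "0 < t" "t < pi / 2"
    using u arcsin_less_arcsin[of 0 u] arcsin_bounded[of u] arcsin_lt_bounded[of u] by (auto simp: t_def)
  have "cos t = sqrt (1 - u\<^sup>2)" using u by (simp add: t_def cos_arcsin)
  also have "1 - u\<^sup>2 = ((a + b)\<^sup>2 - (a - b)\<^sup>2) / (a + b)\<^sup>2"
    using assms by (subst diff_divide_distrib) (simp add: u_def power_divide)
  also have "\<dots> = (a * b) / A\<^sup>2"
    using assms by (simp add: A_def arith_mean_def power_divide) (simp add: power2_eq_square algebra_simps)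
  finally have G: "geom_mean a b = A * cos t"
    using A by (simp add: geom_mean_def real_sqrt_divide)
  have P: "seiffert_mean a b = A * (sin t / t)"
    using assms sin by (simp add: seiffert_mean_def A_def arith_mean_def t_def[symmetric] u_def[symmetric])
      (simp add: u_def field_simps)
  have X: "X_mean a b = A * exp (t * cos t / sin t - 1)"
    using A by (simp add: X_mean_def G P A_def[symmetric] mult.commute)
  have "A * (1 + cos t) < A * (sin t / t + exp (t * cos t / sin t - 1))"
    using one_plus_cos_less[OF t] A by simp
  then show "arith_mean a b + geom_mean a b < seiffert_mean a b + X_mean a b"
    unfolding P X G by (simp add: A_def algebra_simps)
  have "sin t / t < (2 + cos t) / 3"
    using three_sin_less[OF t] t by (simp add: field_simps)
  \<comment> \<open>The weights come from \<open>2/3 + 2/5 = 16/15\<close> and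
    \<open>1/3 + 3/5 = 14/15\<close>.\<close>
  then have "sin t / t + exp (t * cos t / sin t - 1) < 16 / 15 + 14 / 15 * cos t"
    using exp_t_cot_less[OF t] by argo
  then have "A * (sin t / t + exp (t * cos t / sin t - 1)) < A * (16 / 15 + 14 / 15 * cos t)"
    using A by simp
  then show "seiffert_mean a b + X_mean a b < 16 / 15 * arith_mean a b + 14 / 15 * geom_mean a b"
    unfolding P X G by (simp add: A_def algebra_simps)
qed

text \<open>Symmetry reduces the theorem to \<open>b < a\<close>. For the Seiffert mean, swapping
  the arguments changes the sign of both numerator and denominator, since \<open>arcsin\<close> is
  odd.\<close>

lemma mean_commute:
  assumes "a > 0" "b > 0"
  shows
    "arith_mean a b = arith_mean b a"
    "geom_mean a b = geom_mean b a"
    "seiffert_mean a b = seiffert_mean b a"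
    "X_mean a b = X_mean b a"
proof -
  show A: "arith_mean a b = arith_mean b a" and G: "geom_mean a b = geom_mean b a"
    by (simp_all add: arith_mean_def geom_mean_def add.commute mult.commute)
  show P: "seiffert_mean a b = seiffert_mean b a"
  proof -
    have "arcsin (- ((b - a) / (b + a))) = - arcsin ((b - a) / (b + a))"
      using assms by (intro arcsin_minus) (auto simp: field_simps)
    moreover have "- ((b - a) / (b + a)) = (a - b) / (a + b)"
      by (simp add: minus_divide_left add.commute)
    ultimately have "arcsin ((a - b) / (a + b)) = - arcsin ((b - a) / (b + a))" by simp
    then show ?thesis
      unfolding seiffert_mean_def by (simp add: minus_divide_right[symmetric] minus_divide_left)
  qed
  show "X_mean a b = X_mean b a"
    by (simp add: X_mean_def A G P)
qed

theorem theorem2p17: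
  fixes a b :: real
  assumes "a > 0" and "b > 0" and "a \<noteq> b"
  shows "power_mean (1 / 2) a b < (seiffert_mean a b + X_mean a b) / 2
       \<and> (seiffert_mean a b + X_mean a b) / 2
           < power_mean ((5 * ln 2 + 2) / (6 * (ln 2 + 1))) a b"
proof -
  define k :: real where "k = (5 * ln 2 + 2) / (6 * (ln 2 + 1))"
  let ?A = "arith_mean a b" and ?G = "geom_mean a b"
  have lower: "?A + ?G < seiffert_mean a b + X_mean a b"
    and upper: "seiffert_mean a b + X_mean a b < 16 / 15 * ?A + 14 / 15 * ?G"
    using assms seiffert_X_bounds[of b a] seiffert_X_bounds[of a b]
    by (metis linorder_neqE_linordered_idom mean_commute)+
  \<comment> \<open>Clearing denominators turns the first inequality into
    \<open>27 * ln 2 \<ge> 18\<close>.\<close>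
  have k: "8 / 15 \<le> k" "k \<le> 1"
    using ln2_ge_two_thirds by (auto simp: k_def field_simps)
  \<comment> \<open>Since \<open>G \<le> A\<close>, the combination
    \<open>k * A + (1 - k) * G\<close> grows with \<open>k\<close>, so the weight 8/15 may replace
    \<open>k\<close> in the lower bound for the power mean.\<close>
  have "8 / 15 * (?A - ?G) \<le> k * (?A - ?G)"
    using k(1) geom_mean_le_arith_mean[of a b] assms by (intro mult_right_mono) auto
  moreover have "k * ?A + (1 - k) * ?G \<le> power_mean k a b"
    using k assms by (intro power_mean_ge_convex_combination) auto
  ultimately have "8 / 15 * ?A + 7 / 15 * ?G \<le> power_mean k a b"
    by argo
  then show ?thesis
    using lower upper
    unfolding power_mean_half[OF assms(1,2)] k_def[symmetric] by simp
qed

end
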